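(* Let $\mathbf{C}$ be an even snowflake with $M$ edges. If $M\equiv 0\pmod 4$ then $\mathbf{C}$ is conservative; otherwise $\mathbf{C}$ is near-conservative.
   Context: A snowflake is the tree obtained from a disjoint union of stars $S_1,\ldots,S_p$ ($S_i\cong K_{1,n_i}$, $n_i\geq 3$) by identifying one leaf of each star into a single vertex $z$, the center. An internal vertex is a vertex of degree at least $2$. A snowflake is even if every internal vertex other than possibly the center has even degree. A labeling of a graph $G$ is a bijection from $E(G)$ to a set of $|E(G)|$ positive integers. Given an orientation and a labeling $\phi$, the vertex-sum $s(u)$ is the sum of labels of arcs entering $u$ minus the sum of labels of arcs leaving $u$. For $G$ with $M$ edges, a conservative labeling is an (orientation, labeling) pair with label set $[1,M]=\{1,\ldots,M\}$ such that $s(u)=0$ at every vertex of degree at least $3$; a near-conservative labeling is the same with label set $[1,M-1]\cup\{M+1\}$. $G$ is conservative if it admits a conservative labeling, and near-conservative if it is not conservative but admits a near-conservative labeling. *)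

theory Defs
  imports Main
begin

text \<open>Simple graphs: an edge is the two-element set of its end vertices.\<close>

record 'a sgraph =
  vertices :: "'a set"
  edges :: "'a set set"

definition degree :: "'a sgraph \<Rightarrow> 'a \<Rightarrow> nat" where
  "degree G v = card {e \<in> edges G. v \<in> e}"

definition is_leaf :: "'a sgraph \<Rightarrow> 'a \<Rightarrow> bool" where
  "is_leaf G v \<longleftrightarrow> v \<in> vertices G \<and> degree G v = 1"

definition internal :: "'a sgraph \<Rightarrow> 'a \<Rightarrow> bool" where
  "internal G v \<longleftrightarrow> v \<in> vertices G \<and> degree G v \<ge> 2"

text \<open>The star \<open>K\<^bsub>1,n\<^esub>\<close>, with hub \<open>0\<close>.\<close>

definition star :: "nat \<Rightarrow> nat sgraph" where
  "star n = \<lparr>vertices = {0..n}, edges = {{0, j} | j. j \<in> {1..n}}\<rparr>"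

definition disjoint_union :: "'a sgraph list \<Rightarrow> (nat \<times> 'a) sgraph" where
  "disjoint_union Gs =
    \<lparr>vertices = (\<Union>i < length Gs. Pair i ` vertices (Gs ! i)),
     edges = (\<Union>i < length Gs. (\<lambda>e. Pair i ` e) ` edges (Gs ! i))\<rparr>"

text \<open>\<open>G\<close> is, up to renaming of vertices, the graph obtained from \<open>H\<close> by identifying the
  vertices in \<open>L\<close> into the single vertex \<open>z\<close>; \<open>q\<close> is the quotient map.\<close>

definition identification ::
  "'b sgraph \<Rightarrow> 'b set \<Rightarrow> ('b \<Rightarrow> 'a) \<Rightarrow> 'a sgraph \<Rightarrow> 'a \<Rightarrow> bool" where
  "identification H L q G z \<longleftrightarrow>
     vertices G = q ` vertices H \<and>
     edges G = (\<lambda>e. q ` e) ` edges H \<and>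
     (\<forall>v \<in> vertices H. q v = z \<longleftrightarrow> v \<in> L) \<and>
     inj_on q (vertices H - L)"

definition snowflake :: "'a sgraph \<Rightarrow> 'a \<Rightarrow> bool" where
  "snowflake G z \<longleftrightarrow>
     (\<exists>ns l q. ns \<noteq> [] \<and>
        (\<forall>i < length ns. ns ! i \<ge> 3 \<and> is_leaf (star (ns ! i)) (l i)) \<and>
        identification (disjoint_union (map star ns)) {(i, l i) | i. i < length ns} q G z)"

definition even_snowflake :: "'a sgraph \<Rightarrow> 'a \<Rightarrow> bool" where
  "even_snowflake G z \<longleftrightarrow>
     snowflake G z \<and> (\<forall>v. internal G v \<and> v \<noteq> z \<longrightarrow> even (degree G v))"

text \<open>A pair \<open>(u, v)\<close> is an arc leaving \<open>u\<close> and entering \<open>v\<close>.\<close>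

definition orientation :: "'a sgraph \<Rightarrow> ('a \<times> 'a) set \<Rightarrow> bool" where
  "orientation G D \<longleftrightarrow>
     (\<forall>(u, v) \<in> D. {u, v} \<in> edges G) \<and>
     (\<forall>u v. {u, v} \<in> edges G \<longrightarrow> ((u, v) \<in> D) \<noteq> ((v, u) \<in> D))"

definition labeling :: "'a sgraph \<Rightarrow> ('a set \<Rightarrow> nat) \<Rightarrow> nat set \<Rightarrow> bool" where
  "labeling G \<phi> S \<longleftrightarrow>
     finite S \<and> card S = card (edges G) \<and> (\<forall>k \<in> S. k > 0) \<and> bij_betw \<phi> (edges G) S"

definition vertex_sum :: "('a \<times> 'a) set \<Rightarrow> ('a set \<Rightarrow> nat) \<Rightarrow> 'a \<Rightarrow> int" where
  "vertex_sum D \<phi> u =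
     (\<Sum>v | (v, u) \<in> D. int (\<phi> {v, u})) - (\<Sum>v | (u, v) \<in> D. int (\<phi> {u, v}))"

definition balanced_labeling ::
  "'a sgraph \<Rightarrow> nat set \<Rightarrow> ('a \<times> 'a) set \<Rightarrow> ('a set \<Rightarrow> nat) \<Rightarrow> bool" where
  "balanced_labeling G S D \<phi> \<longleftrightarrow>
     orientation G D \<and> labeling G \<phi> S \<and>
     (\<forall>u \<in> vertices G. degree G u \<ge> 3 \<longrightarrow> vertex_sum D \<phi> u = 0)"

definition conservative_labeling ::
  "'a sgraph \<Rightarrow> ('a \<times> 'a) set \<Rightarrow> ('a set \<Rightarrow> nat) \<Rightarrow> bool" where
  "conservative_labeling G = balanced_labeling G {1..card (edges G)}"

definition near_conservative_labeling ::
  "'a sgraph \<Rightarrow> ('a \<times> 'a) set \<Rightarrow> ('a set \<Rightarrow> nat) \<Rightarrow> bool" where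
  "near_conservative_labeling G =
     balanced_labeling G ({1..card (edges G) - 1} \<union> {card (edges G) + 1})"

definition conservative :: "'a sgraph \<Rightarrow> bool" where
  "conservative G \<longleftrightarrow> (\<exists>D \<phi>. conservative_labeling G D \<phi>)"

definition near_conservative :: "'a sgraph \<Rightarrow> bool" where
  "near_conservative G \<longleftrightarrow>
     \<not> conservative G \<and> (\<exists>D \<phi>. near_conservative_labeling G D \<phi>)"

end

theory Submission
  imports Defs "HOL-Library.Disjoint_Sets"
begin

text \<open>
  Every edge meets exactly one hub, so a zero sum at all hubs makes the sum of all labels even;
  for \<open>M mod 4 = 2\<close> the sum of \<open>1, \<dots>, M\<close> is odd, which rules out conservative labelings.

  For the construction, let \<open>L m\<close> be \<open>[1,m]\<close> if \<open>4\<close> divides \<open>m\<close> and \<open>[1,m-1] \<union> {m+1}\<close> otherwise.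
  For even \<open>m\<close>, both \<open>L (m+4) - L m\<close> and \<open>L (m+6) - L m\<close> split into two parts of equal sum,
  hence so does \<open>L (m+n) - L m\<close> for every even \<open>n \<ge> 4\<close>. Adding the stars one by one, give each
  new star such a block of labels, signed so that they cancel at its hub. Two consecutive blocks
  contain elements that differ by \<open>1\<close> and elements that differ by \<open>2\<close>. As the signs within a star may
  be reversed, two stars together contribute any of \<open>\<plusminus>1\<close>, \<open>\<plusminus>2\<close> to the center, and with at least
  three stars these contributions can be made to cancel.
\<close>

section \<open>Label sets and their blocks\<close>

definition labels :: "nat \<Rightarrow> nat set" where
  "labels m = (if 4 dvd m then {1..m} else {1..m - 1} \<union> {m + 1})"

lemma finite_labels [simp]: "finite (labels m)"
  by (simp add: labels_def)

lemma card_labels [simp]: "card (labels m) = m"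
  by (cases m) (auto simp: labels_def)

lemma zero_notin_labels [simp]: "0 \<notin> labels m"
  by (simp add: labels_def)

lemma labels_mono:
  assumes "even k" "even m" "k \<le> m"
  shows "labels k \<subseteq> labels m"
proof (cases "k = m")
  case False
  with assms have "k + 2 \<le> m" by presburger
  then show ?thesis by (auto simp: labels_def)
qed simp

definition equipartitionable :: "nat set \<Rightarrow> bool" where
  "equipartitionable B \<longleftrightarrow> (\<exists>P\<subseteq>B. \<Sum>P = \<Sum>(B - P))"

lemma equipartitionableI:
  assumes "B = P \<union> N" "P \<inter> N = {}" "\<Sum>P = \<Sum>N"
  shows "equipartitionable B"
proof -
  have "B - P = N" using assms by blast
  with assms show ?thesis unfolding equipartitionable_def by (intro exI[of _ P]) auto
qed

lemma equipartitionable_Un: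
  assumes "equipartitionable A" "equipartitionable B" "finite A" "finite B" "A \<inter> B = {}"
  shows "equipartitionable (A \<union> B)"
proof -
  obtain P Q where P: "P \<subseteq> A" "\<Sum>P = \<Sum>(A - P)" and Q: "Q \<subseteq> B" "\<Sum>Q = \<Sum>(B - Q)"
    using assms(1,2) unfolding equipartitionable_def by blast
  show ?thesis
  proof (rule equipartitionableI)
    show "A \<union> B = (P \<union> Q) \<union> ((A - P) \<union> (B - Q))" "(P \<union> Q) \<inter> ((A - P) \<union> (B - Q)) = {}"
      using P(1) Q(1) assms(5) by blast+
    have "\<Sum>(P \<union> Q) = \<Sum>P + \<Sum>Q"
      using P(1) Q(1) assms(3-5) by (intro sum.union_disjoint) (auto intro: finite_subset)
    also have "\<dots> = \<Sum>((A - P) \<union> (B - Q))"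
      using P(2) Q(2) assms(3-5) by (subst sum.union_disjoint) auto
    finally show "\<Sum>(P \<union> Q) = \<Sum>((A - P) \<union> (B - Q))" .
  qed
qed

lemma equipartitionable_labels_diff_4:
  assumes "even m"
  shows "equipartitionable (labels (m + 4) - labels m)"
proof (cases "4 dvd m")
  case True
  then have "labels (m + 4) - labels m = {m + 1, m + 4} \<union> {m + 2, m + 3}"
    unfolding labels_def by auto
  then show ?thesis by (rule equipartitionableI) auto
next
  case False
  with assms have "m \<ge> 2" by presburger
  with False have "labels (m + 4) - labels m = {m, m + 5} \<union> {m + 2, m + 3}"
    unfolding labels_def by auto
  then show ?thesis by (rule equipartitionableI) auto
qed

lemma equipartitionable_labels_diff_6:
  assumes "even m"
  shows "equipartitionable (labels (m + 6) - labels m)"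
proof (cases "4 dvd m")
  case True
  then have "\<not> 4 dvd m + 6" by presburger
  with True have "labels (m + 6) - labels m = {m + 1, m + 3, m + 7} \<union> {m + 2, m + 4, m + 5}"
    unfolding labels_def by auto
  then show ?thesis by (rule equipartitionableI) auto
next
  case False
  with assms have "m \<ge> 2" "4 dvd m + 6" by presburger+
  with False have "labels (m + 6) - labels m = {m, m + 4, m + 6} \<union> {m + 2, m + 3, m + 5}"
    unfolding labels_def by auto
  then show ?thesis by (rule equipartitionableI) auto
qed

lemma equipartitionable_labels_diff:
  assumes "even m" "even n" "n \<ge> 4"
  shows "equipartitionable (labels (m + n) - labels m)"
  using assms
proof (induction n arbitrary: m rule: less_induct)
  case (less n)
  have "n = 4 \<or> n = 6 \<or> (\<exists>k\<ge>4. n = 4 + k)"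
    using less.prems by presburger
  then consider "n = 4" | "n = 6" | k where "n = 4 + k" "k \<ge> 4"
    by blast
  then show ?case
  proof cases
    case (3 k)
    then have "equipartitionable (labels (m + 4 + k) - labels (m + 4))"
      using less.IH[of k "m + 4"] less.prems by simp
    moreover have "labels m \<subseteq> labels (m + 4)" "labels (m + 4) \<subseteq> labels (m + 4 + k)"
      using less.prems 3 by (intro labels_mono; simp)+
    then have "labels (m + n) - labels m =
        (labels (m + 4) - labels m) \<union> (labels (m + 4 + k) - labels (m + 4))"
      using 3 by (auto simp: add.assoc)
    ultimately show ?thesis
      using equipartitionable_labels_diff_4[of m] less.prems by (auto intro!: equipartitionable_Un)
  qed (use less.prems equipartitionable_labels_diff_4 equipartitionable_labels_diff_6 in auto)
qed

lemma ex_consecutive_blocks_diff_eq: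
  assumes "m + 4 \<le> k" "k + 4 \<le> k'" "\<delta> \<in> {1, 2}"
  shows "\<exists>a \<in> labels k - labels m. \<exists>b \<in> labels k' - labels k. \<bar>int b - int a\<bar> = \<delta>"
proof (cases "4 dvd k")
  case True
  then have "k \<in> labels k - labels m" "k + nat \<delta> \<in> labels k' - labels k"
    using assms by (auto simp: labels_def)
  moreover have "\<bar>int (k + nat \<delta>) - int k\<bar> = \<delta>"
    using assms(3) by auto
  ultimately show ?thesis by blast
next
  case False
  then have "k + 1 \<in> labels k - labels m" "k - 2 \<in> labels k - labels m" "k \<in> labels k' - labels k"
    using assms by (auto simp: labels_def)
  moreover have "\<bar>int k - int (k + 1)\<bar> = 1" "\<bar>int k - int (k - 2)\<bar> = 2"
    using assms(1) by auto
  ultimately show ?thesis using assms(3) by blast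
qed

section \<open>Signed labelings of a family of stars\<close>

lemma ex_bij_betw_maps_to:
  assumes "finite A" "finite B" "card A = card B" "a \<in> A" "b \<in> B"
  shows "\<exists>f. bij_betw f A B \<and> f a = b"
proof -
  obtain f where f: "bij_betw f (A - {a}) (B - {b})"
    using finite_same_card_bij[of "A - {a}" "B - {b}"] assms by auto
  have "bij_betw (f(a := b)) (A - {a}) (B - {b})"
    by (rule iffD1[OF bij_betw_cong f]) simp
  then have "bij_betw (f(a := b)) (A - {a} \<union> {a}) (B - {b} \<union> {b})"
    using notIn_Un_bij_betw[of a "A - {a}" "f(a := b)" "B - {b}"] by simp
  moreover have "A - {a} \<union> {a} = A" "B - {b} \<union> {b} = B"
    using assms(4,5) by auto
  ultimately show ?thesis
    by (intro exI[of _ "f(a := b)"]) simp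
qed

abbreviation signed_bij_betw :: "('a \<Rightarrow> int) \<Rightarrow> 'a set \<Rightarrow> nat set \<Rightarrow> bool" where
  "signed_bij_betw w A B \<equiv> bij_betw (\<lambda>x. nat \<bar>w x\<bar>) A B"

lemma ex_zero_sum_signed_bij_betw:
  assumes "equipartitionable B" "finite A" "finite B" "card A = card B"
    and "a \<in> A" "nat \<bar>t\<bar> \<in> B"
  shows "\<exists>w :: 'a \<Rightarrow> int. signed_bij_betw w A B \<and> (\<Sum>x\<in>A. w x) = 0 \<and> w a = t"
proof -
  obtain Q where Q: "Q \<subseteq> B" "\<Sum>Q = \<Sum>(B - Q)"
    using assms(1) unfolding equipartitionable_def by blast
  define P where "P = (if nat \<bar>t\<bar> \<in> Q \<longleftrightarrow> 0 < t then Q else B - Q)"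
  have P: "P \<subseteq> B" "\<Sum>P = \<Sum>(B - P)" "nat \<bar>t\<bar> \<in> P \<longleftrightarrow> 0 < t"
    using Q assms(6) by (auto simp: P_def double_diff)
  obtain f where f: "bij_betw f A B" "f a = nat \<bar>t\<bar>"
    using ex_bij_betw_maps_to assms by metis
  define s :: "nat \<Rightarrow> int" where "s k = (if k \<in> P then int k else - int k)" for k
  have "(\<Sum>x\<in>A. s (f x)) = (\<Sum>k\<in>B. s k)"
    using f(1) by (rule sum.reindex_bij_betw)
  also have "\<dots> = (\<Sum>k\<in>P. s k) + (\<Sum>k\<in>B - P. s k)"
    using sum.subset_diff[OF P(1) assms(3)] by (simp add: add.commute)
  also have "\<dots> = int (\<Sum>P) - int (\<Sum>(B - P))"
    by (simp add: s_def sum_negf)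
  finally have "(\<Sum>x\<in>A. s (f x)) = 0"
    using P(2) by simp
  moreover have "nat \<bar>s k\<bar> = k" for k
    by (simp add: s_def)
  moreover have "s (f a) = t"
    using P(3) f(2) by (auto simp: s_def)
  ultimately show ?thesis
    using f(1) by (intro exI[of _ "\<lambda>x. s (f x)"]) simp
qed

text \<open>\<open>E i\<close> is the edge set of the \<open>i\<close>-th star and \<open>c i\<close> its edge at the center.\<close>

locale even_stars =
  fixes I :: "'i set" and E :: "'i \<Rightarrow> 'e set" and c :: "'i \<Rightarrow> 'e"
  assumes finite_I: "finite I"
    and disjoint_E: "disjoint_family_on E I"
    and even_card_E: "i \<in> I \<Longrightarrow> even (card (E i))"
    and card_E_ge_4: "i \<in> I \<Longrightarrow> card (E i) \<ge> 4"
    and c_in_E: "i \<in> I \<Longrightarrow> c i \<in> E i"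
begin

definition total_card :: "'i set \<Rightarrow> nat" where
  "total_card J = (\<Sum>i\<in>J. card (E i))"

definition block :: "'i set \<Rightarrow> 'i \<Rightarrow> nat set" where
  "block J i = labels (total_card (insert i J)) - labels (total_card J)"

definition attainable :: "'i set \<Rightarrow> int \<Rightarrow> bool" where
  "attainable J d \<longleftrightarrow> (\<exists>w. signed_bij_betw w (\<Union>i\<in>J. E i) (labels (total_card J)) \<and>
     (\<forall>i\<in>J. (\<Sum>e\<in>E i. w e) = 0) \<and> (\<Sum>i\<in>J. w (c i)) = d)"

lemma finite_E: "i \<in> I \<Longrightarrow> finite (E i)"
  using card_E_ge_4 by (metis card.infinite not_numeral_le_zero)

lemma even_total_card: "J \<subseteq> I \<Longrightarrow> even (total_card J)"
  unfolding total_card_def using even_card_E by (intro dvd_sum) auto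

lemma total_card_insert: "\<lbrakk>J \<subseteq> I; i \<notin> J\<rbrakk> \<Longrightarrow> total_card (insert i J) = total_card J + card (E i)"
  unfolding total_card_def using finite_subset[OF _ finite_I] by simp

lemma attainable_empty: "attainable {} 0"
  by (simp add: attainable_def total_card_def labels_def bij_betw_def)

lemma labels_total_card_subset:
  "\<lbrakk>insert i J \<subseteq> I; i \<notin> J\<rbrakk> \<Longrightarrow> labels (total_card J) \<subseteq> labels (total_card (insert i J))"
  by (intro labels_mono even_total_card) (auto simp: total_card_insert)

lemma card_block: "\<lbrakk>insert i J \<subseteq> I; i \<notin> J\<rbrakk> \<Longrightarrow> card (block J i) = card (E i)"
  using labels_total_card_subset[of i J]
  by (simp add: block_def card_Diff_subset total_card_insert)

lemma equipartitionable_block: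
  assumes "insert i J \<subseteq> I" "i \<notin> J"
  shows "equipartitionable (block J i)"
proof -
  have "equipartitionable (labels (total_card J + card (E i)) - labels (total_card J))"
    using assms(1) even_card_E card_E_ge_4 even_total_card
    by (intro equipartitionable_labels_diff) auto
  then show ?thesis using assms by (simp add: block_def total_card_insert)
qed

lemma attainable_insert:
  assumes "attainable J d" and iJ: "insert i J \<subseteq> I" "i \<notin> J"
    and t: "nat \<bar>t\<bar> \<in> block J i"
  shows "attainable (insert i J) (d + t)"
proof -
  obtain v where v: "signed_bij_betw v (E i) (block J i)" "(\<Sum>e\<in>E i. v e) = 0" "v (c i) = t"
    using ex_zero_sum_signed_bij_betw[OF equipartitionable_block[OF iJ], of "E i" "c i" t]
      card_block[OF iJ] finite_E c_in_E iJ t by (auto simp: block_def)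
  obtain w where w: "signed_bij_betw w (\<Union>j\<in>J. E j) (labels (total_card J))"
      "\<forall>j\<in>J. (\<Sum>e\<in>E j. w e) = 0" "(\<Sum>j\<in>J. w (c j)) = d"
    using assms(1) unfolding attainable_def by blast
  define u where "u e = (if e \<in> E i then v e else w e)" for e
  have "E i \<inter> E j = {}" if "j \<in> J" for j
    using disjoint_E iJ that unfolding disjoint_family_on_def by (metis insert_subset subsetD)
  then have u_w: "u e = w e" if "j \<in> J" "e \<in> E j" for e j
    using that by (auto simp: u_def)
  have "signed_bij_betw u (E i) (block J i)"
    by (rule iffD1[OF bij_betw_cong v(1)]) (simp add: u_def)
  moreover have "signed_bij_betw u (\<Union>j\<in>J. E j) (labels (total_card J))"
    by (rule iffD1[OF bij_betw_cong w(1)]) (auto simp: u_w)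
  ultimately have "signed_bij_betw u (E i \<union> (\<Union>j\<in>J. E j)) (block J i \<union> labels (total_card J))"
    by (rule bij_betw_combine) (auto simp: block_def)
  moreover have "block J i \<union> labels (total_card J) = labels (total_card (insert i J))"
    using labels_total_card_subset[OF iJ] by (auto simp: block_def)
  moreover have "(\<Sum>e\<in>E j. u e) = 0" if "j \<in> insert i J" for j
    using that v(2) w(2) u_w by (cases "j = i") (simp_all add: u_def)
  moreover have "(\<Sum>j\<in>J. u (c j)) = (\<Sum>j\<in>J. w (c j))"
    using iJ c_in_E by (intro sum.cong) (auto simp: u_w)
  then have "(\<Sum>j\<in>insert i J. u (c j)) = d + t"
    using iJ v(3) w(3) c_in_E finite_subset[OF _ finite_I] by (simp add: u_def)
  ultimately show ?thesis
    unfolding attainable_def by (intro exI[of _ u]) simp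
qed

lemma attainable_insert2:
  assumes "attainable J d" "J \<subseteq> I" "i \<in> I - J" "i' \<in> I - J" "i \<noteq> i'" "\<bar>\<delta>\<bar> \<in> {1, 2}"
  shows "attainable (insert i' (insert i J)) (d + \<delta>)"
proof -
  have "total_card J + 4 \<le> total_card (insert i J)"
      "total_card (insert i J) + 4 \<le> total_card (insert i' (insert i J))"
    using assms(2-5) card_E_ge_4 by (auto simp: total_card_insert)
  then obtain a b where a: "a \<in> block J i" and b: "b \<in> block (insert i J) i'"
      and diff: "\<bar>int b - int a\<bar> = \<bar>\<delta>\<bar>"
    using ex_consecutive_blocks_diff_eq assms(6) unfolding block_def by blast
  have "\<delta> = - int a + int b \<or> \<delta> = int a + - int b"
    using diff by linarith
  then obtain s t where "\<delta> = s + t" "\<bar>s\<bar> = int a" "\<bar>t\<bar> = int b"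
    by (metis abs_minus_cancel abs_of_nat)
  moreover from this have "attainable (insert i' (insert i J)) (d + s + t)"
    using assms a b by (intro attainable_insert) auto
  ultimately show ?thesis by (simp add: add.assoc)
qed

lemma attainable_singleton:
  assumes "i \<in> I" "t \<in> {1, 2}"
  shows "attainable {i} t"
proof -
  have "nat \<bar>t\<bar> \<in> block {} i"
    using assms card_E_ge_4[of i] by (auto simp: block_def total_card_def labels_def)
  then show ?thesis
    using attainable_insert[of "{}" 0 i t] attainable_empty assms(1) by simp
qed

lemma attainable_1_2:
  assumes "J \<subseteq> I" "J \<noteq> {}"
  shows "attainable J 1 \<and> attainable J 2"
  using finite_subset[OF assms(1) finite_I] assms
proof (induction J rule: finite_psubset_induct)
  case (psubset J)
  then obtain i where i: "i \<in> J" by blast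
  show ?case
  proof (cases "J = {i}")
    case True
    then show ?thesis using attainable_singleton psubset.prems(1) by simp
  next
    case False
    then obtain i' where i': "i' \<in> J" "i' \<noteq> i" using i by blast
    define K where "K = J - {i, i'}"
    have J: "J = insert i' (insert i K)" and K: "K \<subset> J" "K \<subseteq> I"
      using i i' psubset.prems(1) by (auto simp: K_def)
    have add: "attainable J (d + \<delta>)" if "attainable K d" "\<bar>\<delta>\<bar> \<in> {1, 2}" for d \<delta>
      unfolding J using that i i' psubset.prems(1) K(2)
      by (intro attainable_insert2) (auto simp: K_def)
    show ?thesis
    proof (cases "K = {}")
      case True
      then show ?thesis using add[of 0 1] add[of 0 2] attainable_empty by simp
    next
      case False
      then have "attainable K 1" "attainable K 2" using psubset.IH K by auto
      then show ?thesis using add[of 2 "-1"] add[of 1 1] by simp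
    qed
  qed
qed

lemma attainable_0:
  assumes "J \<subseteq> I" "card J \<ge> 3"
  shows "attainable J 0"
proof -
  obtain i i' K where J: "J = insert i (insert i' K)" "i \<notin> insert i' K" "i' \<notin> K" "K \<noteq> {}"
    using assms(2) by (auto simp: numeral_3_eq_3 card_le_Suc_iff)
  then have "attainable K 1" using attainable_1_2[of K] assms(1) by auto
  then show ?thesis
    using attainable_insert2[of K 1 i' i "-1"] J assms(1) by auto
qed

lemma card_UN_E: "card (\<Union>i\<in>I. E i) = total_card I"
  unfolding total_card_def using finite_I finite_E disjoint_E
  by (intro card_UN_disjoint) (auto simp: disjoint_family_on_def)

lemma ex_signed_labeling:
  "\<exists>w. signed_bij_betw w (\<Union>i\<in>I. E i) (labels (card (\<Union>i\<in>I. E i))) \<and>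
    (\<forall>i\<in>I. (\<Sum>e\<in>E i. w e) = 0) \<and> (card I \<ge> 3 \<longrightarrow> (\<Sum>i\<in>I. w (c i)) = 0)"
proof -
  have "\<exists>d. attainable I d \<and> (card I \<ge> 3 \<longrightarrow> d = 0)"
    using attainable_empty attainable_1_2[of I] attainable_0[of I] by fastforce
  then show ?thesis unfolding attainable_def card_UN_E by metis
qed

end

section \<open>Orientations and vertex sums of bipartite graphs\<close>

definition neighbours :: "'a sgraph \<Rightarrow> 'a \<Rightarrow> 'a set" where
  "neighbours G u = {v. {u, v} \<in> edges G}"

definition incident_edges :: "'a sgraph \<Rightarrow> 'a \<Rightarrow> 'a set set" where
  "incident_edges G u = {e \<in> edges G. u \<in> e}"

lemma degree_eq_card_incident_edges: "degree G u = card (incident_edges G u)"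
  by (simp add: degree_def incident_edges_def)

locale finite_graph =
  fixes G :: "'a sgraph"
  assumes finite_edges: "finite (edges G)"
    and edge_doubleton: "e \<in> edges G \<Longrightarrow> \<exists>u v. e = {u, v}"
begin

lemma finite_incident_edges: "finite (incident_edges G u)"
  using finite_edges by (simp add: incident_edges_def)

lemma bij_betw_neighbours: "bij_betw (\<lambda>v. {u, v}) (neighbours G u) (incident_edges G u)"
proof -
  have "incident_edges G u = (\<lambda>v. {u, v}) ` neighbours G u"
    using edge_doubleton by (fastforce simp: incident_edges_def neighbours_def insert_commute)
  then show ?thesis
    by (auto simp: bij_betw_def inj_on_def doubleton_eq_iff)
qed

lemma finite_neighbours: "finite (neighbours G u)"
  using bij_betw_finite[OF bij_betw_neighbours] finite_incident_edges by blast

lemma degree_eq_card_neighbours: "degree G u = card (neighbours G u)"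
  using bij_betw_same_card[OF bij_betw_neighbours] by (simp add: degree_eq_card_incident_edges)

lemma sum_incident_edges: "(\<Sum>e\<in>incident_edges G u. f e) = (\<Sum>v\<in>neighbours G u. f {u, v})"
  using sum.reindex_bij_betw[OF bij_betw_neighbours] by metis

lemma vertex_sum_eq_sum_neighbours:
  assumes D: "orientation G D"
  shows "vertex_sum D \<phi> u =
    (\<Sum>v\<in>neighbours G u. if (v, u) \<in> D then int (\<phi> {u, v}) else - int (\<phi> {u, v}))"
proof -
  have "{v. (v, u) \<in> D} = neighbours G u \<inter> {v. (v, u) \<in> D}"
    using D unfolding orientation_def neighbours_def by (auto simp: insert_commute)
  moreover have "{v. (u, v) \<in> D} = neighbours G u \<inter> - {v. (v, u) \<in> D}"
    using D unfolding orientation_def neighbours_def by blast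
  ultimately show ?thesis
    unfolding vertex_sum_def sum.If_cases[OF finite_neighbours]
    by (simp add: sum_negf insert_commute)
qed

lemma even_vertex_sum_iff:
  assumes "orientation G D"
  shows "even (vertex_sum D \<phi> u) \<longleftrightarrow> even (\<Sum>e\<in>incident_edges G u. \<phi> e)"
proof -
  have "even (\<Sum>v\<in>neighbours G u.
      (if (v, u) \<in> D then int (\<phi> {u, v}) else - int (\<phi> {u, v})) - int (\<phi> {u, v}))"
    by (intro dvd_sum) auto
  then have "even (vertex_sum D \<phi> u - int (\<Sum>e\<in>incident_edges G u. \<phi> e))"
    by (simp add: vertex_sum_eq_sum_neighbours[OF assms] sum_incident_edges sum_subtractf)
  then show ?thesis by (simp del: of_nat_sum)
qed

end

locale bipartite_graph = finite_graph G for G :: "'a sgraph" +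
  fixes H :: "'a set"
  assumes finite_H: "finite H"
    and bipartite: "{u, v} \<in> edges G \<Longrightarrow> u \<in> H \<longleftrightarrow> v \<notin> H"
begin

lemma edges_eq_UN_incident_edges: "edges G = (\<Union>u\<in>H. incident_edges G u)"
  using edge_doubleton bipartite unfolding incident_edges_def by fastforce

lemma disjoint_incident_edges: "disjoint_family_on (incident_edges G) H"
  using edge_doubleton bipartite unfolding disjoint_family_on_def incident_edges_def by fastforce

lemma even_sum_labels:
  assumes "balanced_labeling G S D \<phi>" and H: "\<And>u. u \<in> H \<Longrightarrow> u \<in> vertices G \<and> degree G u \<ge> 3"
  shows "even (\<Sum>S)"
proof -
  have D: "orientation G D" and bij: "bij_betw \<phi> (edges G) S"
    and hub_sum: "\<And>u. u \<in> H \<Longrightarrow> vertex_sum D \<phi> u = 0"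
    using assms unfolding balanced_labeling_def labeling_def by auto
  have "\<Sum>S = (\<Sum>e\<in>edges G. \<phi> e)"
    using sum.reindex_bij_betw[OF bij, of "\<lambda>k. k"] by simp
  also have "\<dots> = (\<Sum>u\<in>H. \<Sum>e\<in>incident_edges G u. \<phi> e)"
    unfolding edges_eq_UN_incident_edges using finite_H finite_incident_edges disjoint_incident_edges
    by (intro sum.UNION_disjoint) (auto simp: disjoint_family_on_def)
  also have "even \<dots>"
    by (rule dvd_sum) (simp add: hub_sum flip: even_vertex_sum_iff[OF D])
  finally show ?thesis .
qed

definition signed_arcs :: "('a set \<Rightarrow> int) \<Rightarrow> ('a \<times> 'a) set" where
  "signed_arcs w = {(v, u). {u, v} \<in> edges G \<and> (u \<in> H \<longleftrightarrow> w {u, v} > 0)}"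

lemma orientation_signed_arcs: "orientation G (signed_arcs w)"
  using bipartite unfolding orientation_def signed_arcs_def by (auto simp: insert_commute)

lemma vertex_sum_signed_arcs:
  "vertex_sum (signed_arcs w) (\<lambda>e. nat \<bar>w e\<bar>) u =
    (if u \<in> H then 1 else - 1) * (\<Sum>e\<in>incident_edges G u. w e)"
  unfolding vertex_sum_eq_sum_neighbours[OF orientation_signed_arcs] sum_incident_edges
    sum_distrib_left
  by (intro sum.cong) (auto simp: signed_arcs_def neighbours_def)

lemma balanced_labeling_signed_arcs:
  assumes bij: "signed_bij_betw w (edges G) S" and "0 \<notin> S"
    and zero_sum: "\<And>u. \<lbrakk>u \<in> vertices G; degree G u \<ge> 3\<rbrakk> \<Longrightarrow> (\<Sum>e\<in>incident_edges G u. w e) = 0"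
  shows "balanced_labeling G S (signed_arcs w) (\<lambda>e. nat \<bar>w e\<bar>)"
proof -
  have "labeling G (\<lambda>e. nat \<bar>w e\<bar>) S"
    using bij_betw_same_card[OF bij] bij_betw_finite[OF bij] finite_edges bij \<open>0 \<notin> S\<close>
    unfolding labeling_def by (auto intro: gr0I)
  then show ?thesis
    using orientation_signed_arcs zero_sum
    by (simp add: balanced_labeling_def vertex_sum_signed_arcs)
qed

end

section \<open>Snowflakes\<close>

lemma even_Sum_atLeastAtMost_iff: "even (\<Sum>{1..n}) \<longleftrightarrow> n mod 4 \<in> {0, 3}" for n :: nat
proof (induction n)
  case (Suc n)
  have "even (\<Sum>{1..Suc n}) \<longleftrightarrow> (even (\<Sum>{1..n}) \<longleftrightarrow> odd n)"
    by simp
  with Suc show ?case by simp presburger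
qed simp

locale snowflake_graph = bipartite_graph G H for G :: "'a sgraph" and H :: "'a set" +
  fixes z :: 'a
  assumes hubs_in_vertices: "H \<subseteq> vertices G"
    and degree_hub: "u \<in> H \<Longrightarrow> degree G u \<ge> 3"
    and center_notin_hubs: "z \<notin> H"
    and center_edge: "u \<in> H \<Longrightarrow> {u, z} \<in> edges G"
    and degree_leaf: "\<lbrakk>v \<in> vertices G; v \<notin> H; v \<noteq> z\<rbrakk> \<Longrightarrow> degree G v \<le> 1"
begin

lemma neighbours_center: "neighbours G z = H"
  using bipartite[of z] center_notin_hubs center_edge
  by (auto simp: neighbours_def insert_commute)

lemma conservative_imp_card_edges_mod_4:
  assumes "conservative G"
  shows "card (edges G) mod 4 \<in> {0, 3}"
proof -
  have "even (\<Sum>{1..card (edges G)})"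
    using assms even_sum_labels hubs_in_vertices degree_hub
    unfolding conservative_def conservative_labeling_def by blast
  then show ?thesis by (simp only: even_Sum_atLeastAtMost_iff)
qed

end

locale even_snowflake_graph = snowflake_graph +
  assumes even_degree_hub: "u \<in> H \<Longrightarrow> even (degree G u)"
begin

sublocale even_stars H "incident_edges G" "\<lambda>u. {u, z}"
proof
  fix u assume u: "u \<in> H"
  then show "even (card (incident_edges G u))"
    using even_degree_hub by (simp flip: degree_eq_card_incident_edges)
  then show "card (incident_edges G u) \<ge> 4"
    using degree_hub[OF u] unfolding degree_eq_card_incident_edges by presburger
  show "{u, z} \<in> incident_edges G u"
    using center_edge[OF u] by (simp add: incident_edges_def)
qed (rule finite_H disjoint_incident_edges)+

lemma even_card_edges: "even (card (edges G))"
  unfolding edges_eq_UN_incident_edges card_UN_E by (simp add: even_total_card)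

lemma ex_balanced_labeling: "\<exists>D \<phi>. balanced_labeling G (labels (card (edges G))) D \<phi>"
proof -
  obtain w where w: "signed_bij_betw w (edges G) (labels (card (edges G)))"
      "\<forall>u\<in>H. (\<Sum>e\<in>incident_edges G u. w e) = 0" "card H \<ge> 3 \<longrightarrow> (\<Sum>u\<in>H. w {u, z}) = 0"
    using ex_signed_labeling unfolding edges_eq_UN_incident_edges by blast
  have "(\<Sum>e\<in>incident_edges G u. w e) = 0" if u: "u \<in> vertices G" "degree G u \<ge> 3" for u
  proof -
    consider "u \<in> H" | "u = z"
      using degree_leaf[OF u(1)] u(2) by fastforce
    then show ?thesis
    proof cases
      case 2
      then have "card H \<ge> 3"
        using u(2) by (simp add: degree_eq_card_neighbours neighbours_center)
      then show ?thesis
        using w(3) 2 by (simp add: sum_incident_edges neighbours_center insert_commute)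
    qed (use w(2) in blast)
  qed
  then show ?thesis
    using balanced_labeling_signed_arcs[OF w(1) zero_notin_labels] by blast
qed

lemma conservative_if_4_dvd:
  assumes "4 dvd card (edges G)"
  shows "conservative G"
  using ex_balanced_labeling assms
  by (simp add: conservative_def conservative_labeling_def labels_def)

lemma near_conservative_if_not_4_dvd:
  assumes "\<not> 4 dvd card (edges G)"
  shows "near_conservative G"
proof -
  have "card (edges G) mod 4 = 2"
    using even_card_edges assms by presburger
  then have "\<not> conservative G"
    using conservative_imp_card_edges_mod_4 by auto
  then show ?thesis
    using ex_balanced_labeling assms
    by (simp add: near_conservative_def near_conservative_labeling_def labels_def)
qed

end

lemma edges_star: "edges (star n) = (\<lambda>j. {0, j}) ` {1..n}"
  by (auto simp: star_def)

lemma degree_star_hub: "degree (star n) 0 = n"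
proof -
  have "{e \<in> edges (star n). 0 \<in> e} = (\<lambda>j. {0, j}) ` {1..n}"
    by (auto simp: edges_star)
  moreover have "inj_on (\<lambda>j. {0 :: nat, j}) {1..n}"
    by (auto simp: inj_on_def doubleton_eq_iff)
  ultimately show ?thesis by (simp add: degree_def card_image)
qed

lemma leaf_star_in_atLeastAtMost:
  assumes "is_leaf (star n) v" "n \<noteq> 1"
  shows "v \<in> {1..n}"
proof -
  have "v \<le> n" using assms(1) by (simp add: is_leaf_def star_def)
  moreover have "v \<noteq> 0"
    using assms degree_star_hub[of n] by (cases "v = 0") (simp_all add: is_leaf_def)
  ultimately show ?thesis by simp
qed

lemma identification_eq_iff:
  assumes "identification K L q G z" "u \<in> vertices K" "v \<in> vertices K"
  shows "q u = q v \<longleftrightarrow> u = v \<or> u \<in> L \<and> v \<in> L"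
  using assms unfolding identification_def inj_on_def by (metis DiffI)

lemma vertices_disjoint_union_stars:
  "vertices (disjoint_union (map star ns)) = (SIGMA i:{..<length ns}. {0..ns ! i})"
  by (auto simp: disjoint_union_def star_def)

lemma edges_disjoint_union_stars:
  "edges (disjoint_union (map star ns)) =
    (\<lambda>(i, j). {(i, 0), (i, j)}) ` (SIGMA i:{..<length ns}. {1..ns ! i})"
  by (force simp: disjoint_union_def edges_star image_image)

locale star_quotient =
  fixes ns :: "nat list" and l :: "nat \<Rightarrow> nat" and q :: "nat \<times> nat \<Rightarrow> 'a"
    and G :: "'a sgraph" and z :: 'a
  assumes star_size: "i < length ns \<Longrightarrow> ns ! i \<ge> 3"
    and identified_leaf: "i < length ns \<Longrightarrow> l i \<in> {1..ns ! i}"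
    and quotient: "identification (disjoint_union (map star ns)) {(i, l i) | i. i < length ns} q G z"
begin

definition hubs :: "'a set" where
  "hubs = (\<lambda>i. q (i, 0)) ` {..<length ns}"

lemma q_eq_iff:
  assumes "i < length ns" "j \<le> ns ! i" "i' < length ns" "j' \<le> ns ! i'"
  shows "q (i, j) = q (i', j') \<longleftrightarrow> i = i' \<and> j = j' \<or> j = l i \<and> j' = l i'"
  using identification_eq_iff[OF quotient, of "(i, j)" "(i', j')"] assms
  by (auto simp: vertices_disjoint_union_stars)

lemma q_eq_center_iff: "\<lbrakk>i < length ns; j \<le> ns ! i\<rbrakk> \<Longrightarrow> q (i, j) = z \<longleftrightarrow> j = l i"
  using quotient unfolding identification_def by (auto simp: vertices_disjoint_union_stars)

lemma q_in_hubs_iff: "\<lbrakk>i < length ns; j \<le> ns ! i\<rbrakk> \<Longrightarrow> q (i, j) \<in> hubs \<longleftrightarrow> j = 0"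
  using identified_leaf by (fastforce simp: hubs_def q_eq_iff)

lemma vertices_eq: "vertices G = q ` (SIGMA i:{..<length ns}. {0..ns ! i})"
  using quotient unfolding identification_def vertices_disjoint_union_stars by blast

lemma edges_eq: "edges G = (\<lambda>(i, j). {q (i, 0), q (i, j)}) ` (SIGMA i:{..<length ns}. {1..ns ! i})"
  using quotient unfolding identification_def edges_disjoint_union_stars
  by (simp add: image_image case_prod_unfold)

lemma edge_cases:
  assumes "{u, v} \<in> edges G"
  obtains i j where "i < length ns" "j \<in> {1..ns ! i}"
    "u = q (i, 0) \<and> v = q (i, j) \<or> u = q (i, j) \<and> v = q (i, 0)"
  using assms unfolding edges_eq by (auto simp: doubleton_eq_iff)

lemma edge_hub: "\<lbrakk>i < length ns; j \<in> {1..ns ! i}\<rbrakk> \<Longrightarrow> {q (i, 0), q (i, j)} \<in> edges G"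
  unfolding edges_eq by force

sublocale finite_graph G
  by unfold_locales (auto simp: edges_eq)

sublocale bipartite_graph G hubs
proof
  show "finite hubs" by (simp add: hubs_def)
  show "u \<in> hubs \<longleftrightarrow> v \<notin> hubs" if "{u, v} \<in> edges G" for u v
    using that by (rule edge_cases) (auto simp: q_in_hubs_iff)
qed

lemma degree_hub_ge:
  assumes "i < length ns"
  shows "degree G (q (i, 0)) \<ge> ns ! i"
proof -
  have "inj_on (\<lambda>j. q (i, j)) {1..ns ! i}"
    using assms by (auto simp: inj_on_def q_eq_iff)
  then have "ns ! i = card ((\<lambda>j. q (i, j)) ` {1..ns ! i})"
    by (simp add: card_image)
  also have "\<dots> \<le> card (neighbours G (q (i, 0)))"
    using edge_hub[OF assms] finite_neighbours by (intro card_mono) (auto simp: neighbours_def)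
  finally show ?thesis by (simp add: degree_eq_card_neighbours)
qed

lemma degree_leaf_le_1:
  assumes "i < length ns" "j \<in> {1..ns ! i}" "j \<noteq> l i"
  shows "degree G (q (i, j)) \<le> 1"
proof -
  have "neighbours G (q (i, j)) \<subseteq> {q (i, 0)}"
  proof
    fix v assume "v \<in> neighbours G (q (i, j))"
    then have "{q (i, j), v} \<in> edges G" by (simp add: neighbours_def)
    then show "v \<in> {q (i, 0)}"
      by (rule edge_cases) (use assms in \<open>auto simp: q_eq_iff\<close>)
  qed
  then show ?thesis
    using card_mono[of "{q (i, 0)}"] by (simp add: degree_eq_card_neighbours)
qed

sublocale snowflake_graph G hubs z
proof
  show "hubs \<subseteq> vertices G"
    by (auto simp: hubs_def vertices_eq)
  show "degree G u \<ge> 3" if "u \<in> hubs" for u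
    using that star_size degree_hub_ge unfolding hubs_def by fastforce
  show "z \<notin> hubs"
    using identified_leaf q_eq_center_iff by (fastforce simp: hubs_def)
  show "{u, z} \<in> edges G" if "u \<in> hubs" for u
    using that edge_hub identified_leaf q_eq_center_iff by (fastforce simp: hubs_def)
  show "degree G v \<le> 1" if v: "v \<in> vertices G" "v \<notin> hubs" "v \<noteq> z" for v
  proof -
    obtain i j where "i < length ns" "j \<le> ns ! i" "v = q (i, j)"
      using v(1) by (auto simp: vertices_eq)
    then show ?thesis
      using v(2,3) degree_leaf_le_1[of i j] by (simp add: q_in_hubs_iff q_eq_center_iff)
  qed
qed

end

lemma snowflake_imp_snowflake_graph:
  assumes "snowflake G z"
  shows "\<exists>H. snowflake_graph G H z"
proof -
  obtain ns l q where "\<forall>i < length ns. ns ! i \<ge> 3 \<and> is_leaf (star (ns ! i)) (l i)"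
    and "identification (disjoint_union (map star ns)) {(i, l i) | i. i < length ns} q G z"
    using assms unfolding snowflake_def by blast
  then interpret star_quotient ns l q G z
    by unfold_locales (fastforce dest: leaf_star_in_atLeastAtMost)+
  show ?thesis using snowflake_graph_axioms by blast
qed

lemma even_snowflake_imp_even_snowflake_graph:
  assumes "even_snowflake G z"
  shows "\<exists>H. even_snowflake_graph G H z"
proof -
  obtain H where "snowflake_graph G H z"
    using assms snowflake_imp_snowflake_graph[of G z] by (auto simp: even_snowflake_def)
  then interpret snowflake_graph G H z .
  have "even (degree G u)" if "u \<in> H" for u
  proof -
    have "internal G u" "u \<noteq> z"
      using that hubs_in_vertices degree_hub[OF that] center_notin_hubs by (auto simp: internal_def)
    then show ?thesis using assms by (simp add: even_snowflake_def)
  qed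
  then have "even_snowflake_graph G H z" by unfold_locales
  then show ?thesis by blast
qed

theorem theorem29:
  fixes C :: "'a sgraph" and z :: 'a and M :: nat
  assumes "even_snowflake C z"
    and "M = card (edges C)"
  shows "(M mod 4 = 0 \<longrightarrow> conservative C) \<and> (M mod 4 \<noteq> 0 \<longrightarrow> near_conservative C)"
proof -
  obtain H where "even_snowflake_graph C H z"
    using even_snowflake_imp_even_snowflake_graph[OF assms(1)] by blast
  then interpret even_snowflake_graph C H z .
  show ?thesis
    using conservative_if_4_dvd near_conservative_if_not_4_dvd assms(2)
    by (auto simp: mod_eq_0_iff_dvd)
qed

end
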